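(* Let $m,n\ge 1$ be integers and let $a>1$ be a fixed real number. Then $$\chi_{\mathcal{A}_n^{(m)}}(t)=\chi_{\mathcal{C}_n^{(m)}}(t-1).$$
   Context: $\mathcal{A}_n^{(m)}$ denotes the hyperplane arrangement in $\mathbb{R}^n$ given by $\{x_i=0 \mid i\in[n]\}\cup\{x_i=a^kx_j \mid k\in[-m,m],\ 1\le i<j\le n\}$, and $\mathcal{C}_n^{(m)}$ (the $m$-Catalan arrangement) denotes the arrangement in $\mathbb{R}^n$ given by $\{x_i-x_j=k\mid k\in[-m,m],\ 1\le i<j\le n\}$, where $[n]=\{1,\dots,n\}$ and $[-m,m]$ is the set of integers from $-m$ to $m$. The intersection poset $\mathrm{L}(\mathcal{A})$ of an arrangement $\mathcal{A}$ in $\mathbb{R}^n$ is the set of flats (nonempty intersections of some of the hyperplanes, including the empty intersection $\mathbb{R}^n$), ordered by reverse inclusion, with minimum $\hat 0=\mathbb{R}^n$. The characteristic polynomial is $\chi_{\mathcal{A}}(t)=\sum_{x\in \mathrm{L}(\mathcal{A})}\mu(\hat 0,x)\,t^{\dim x}$, where $\mu$ is the Möbius function of $\mathrm{L}(\mathcal{A})$. *)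

theory Defs
  imports "HOL-Analysis.Analysis" "HOL-Computational_Algebra.Polynomial"
begin

text \<open>Moebius function of a locally finite poset, given as a relation; it takes the value 0 on pairs
  that are not comparable.  The guard on the relation and on the interval only secures termination.\<close>

function moebius :: "'a rel \<Rightarrow> 'a \<Rightarrow> 'a \<Rightarrow> int" where
  "moebius r x y =
    (if Partial_order r \<and> (x, y) \<in> r \<and> finite {z. (x, z) \<in> r \<and> (z, y) \<in> r}
     then if x = y then 1
          else - (\<Sum>z \<in> {z. (x, z) \<in> r \<and> (z, y) \<in> r \<and> z \<noteq> y}. moebius r x z)
     else 0)"
  by pat_completeness auto
termination
proof (relation "Wellfounded.measure (\<lambda>(r, x, y). card {z. (x, z) \<in> r \<and> (z, y) \<in> r})", goal_cases)
  case 1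
  show ?case by simp
next
  case (2 r x y z)
  from 2 have po: "Partial_order r" and fin: "finite {w. (x, w) \<in> r \<and> (w, y) \<in> r}"
    and xy: "(x, y) \<in> r" and z: "(x, z) \<in> r" "(z, y) \<in> r" "z \<noteq> y"
    by auto
  have "trans r" "antisym r" "(y, y) \<in> r"
    using po xy by (auto simp: partial_order_on_def preorder_on_def refl_on_def Field_def)
  then have "{w. (x, w) \<in> r \<and> (w, z) \<in> r} \<subset> {w. (x, w) \<in> r \<and> (w, y) \<in> r}"
    using z xy by (auto dest: transD antisymD)
  then show ?case
    using psubset_card_mono[OF fin] by simp
qed

declare moebius.simps [simp del]

text \<open>An arrangement is a set of hyperplanes.  Since \<open>\<Inter>{} = UNIV\<close>, the whole space is a flat.\<close>

definition flats :: "'a::euclidean_space set set \<Rightarrow> 'a set set" where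
  "flats A = {\<Inter>B | B. B \<subseteq> A \<and> \<Inter>B \<noteq> {}}"

definition intersection_poset :: "'a::euclidean_space set set \<Rightarrow> 'a set rel" where
  "intersection_poset A = {(X, Y). X \<in> flats A \<and> Y \<in> flats A \<and> X \<supseteq> Y}"

text \<open>Flats are nonempty affine subspaces, so \<open>aff_dim\<close> is nonnegative on them.
  The sum is meaningful for finite arrangements only.\<close>

definition characteristic_poly :: "'a::euclidean_space set set \<Rightarrow> int poly" where
  "characteristic_poly A =
    (\<Sum>X \<in> flats A. monom (moebius (intersection_poset A) UNIV X) (nat (aff_dim X)))"

text \<open>The index set \<open>[n]\<close> is an arbitrary finite linearly ordered type \<open>'n\<close> with \<open>n = CARD('n)\<close>.\<close>

definition exp_catalan_arrangement ::
    "nat \<Rightarrow> real \<Rightarrow> (real ^ 'n::{finite,linorder}) set set" where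
  "exp_catalan_arrangement m a =
    {{x. x $ i = 0} | i. True} \<union>
    {{x. x $ i = a powi k * x $ j} | i j k. k \<in> {- int m..int m} \<and> i < j}"

definition catalan_arrangement :: "nat \<Rightarrow> (real ^ 'n::{finite,linorder}) set set" where
  "catalan_arrangement m =
    {{x. x $ i - x $ j = of_int k} | i j k. k \<in> {- int m..int m} \<and> i < j}"

end

theory Submission
  imports Defs
begin

text \<open>
  Whitney's theorem turns each characteristic polynomial into a signed sum over the subfamilies of
  hyperplanes with nonempty intersection, which reduces the claim to counting dimensions.

  Call \<open>x\<^sub>i = a\<^sup>k x\<^sub>j\<close> and \<open>x\<^sub>i - x\<^sub>j = k\<close> the multiplicative and the additive form of the
  triple \<open>(i, j, k)\<close>.  A subfamily of the exponential arrangement is a pair \<open>(T, S)\<close> of a set \<open>T\<close> of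
  triples and a set \<open>S\<close> of coordinates that are required to vanish, and its intersection always
  contains the origin.  Fix \<open>T\<close>, let \<open>V\<close> be the solution space of the multiplicative
  equations and \<open>W\<close> that of the additive ones, and sum over \<open>S\<close> alone.

  If \<open>W\<close> is empty, some coordinate \<open>i\<close> vanishes identically on \<open>V\<close>: otherwise a generic \<open>x\<close> in \<open>V\<close>
  has no zero coordinate, and the logarithms of the \<open>\<bar>x\<^sub>i\<bar>\<close> to base \<open>a\<close> solve the additive system.
  Adding \<open>i\<close> to \<open>S\<close> or removing it then leaves the intersection unchanged and flips the sign, so the
  sum over \<open>S\<close> is zero, in agreement with the absence of \<open>T\<close> from Whitney's sum for the Catalan
  arrangement.

  If \<open>W\<close> contains a point \<open>y\<close>, translation by \<open>y\<close> in \<open>W\<close> and the scaling of the coordinates by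
  \<open>a\<close> to the power \<open>y\<^sub>i\<close> in \<open>V\<close> turn both systems into the same equations \<open>z\<^sub>i = z\<^sub>j\<close>.  These identify
  the coordinates within each of \<open>d = dim W\<close> classes, and imposing the zeros in \<open>S\<close> leaves one free
  parameter for each class that \<open>S\<close> misses.  Summing over \<open>S\<close>, every class contributes \<open>t\<close> (it is
  missed) plus the signed number of its nonempty subsets, which is \<open>-1\<close>.  The total
  \<open>(t - 1)\<^sup>d\<close> is the term of \<open>T\<close> in the Catalan sum, evaluated at \<open>t - 1\<close>.
  Lemma \<open>sum_over_coordinate_subsets\<close> states the two cases together.
\<close>

section \<open>Alternating sums over subsets\<close>

lemma alternating_sum_Pow_insert:
  fixes f :: "'b set \<Rightarrow> 'c::comm_ring_1"
  assumes "finite J" "i \<notin> J"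
  shows "(\<Sum>S\<in>Pow (insert i J). (-1) ^ card S * f S) =
    (\<Sum>S\<in>Pow J. (-1) ^ card S * f S) - (\<Sum>S\<in>Pow J. (-1) ^ card S * f (insert i S))"
proof -
  have inj: "inj_on (insert i) (Pow J)"
    using assms(2) by (auto simp: inj_on_def)
  have card: "card (insert i S) = Suc (card S)" if "S \<in> Pow J" for S
    using that assms finite_subset[of S J] by (auto intro!: card_insert_disjoint)
  have "(\<Sum>S\<in>Pow (insert i J). (-1) ^ card S * f S) =
      (\<Sum>S\<in>Pow J. (-1) ^ card S * f S) + (\<Sum>S\<in>insert i ` Pow J. (-1) ^ card S * f S)"
    unfolding Pow_insert using assms by (intro sum.union_disjoint) auto
  also have "(\<Sum>S\<in>insert i ` Pow J. (-1) ^ card S * f S) =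
      - (\<Sum>S\<in>Pow J. (-1) ^ card S * f (insert i S))"
    by (simp add: sum.reindex[OF inj] card sum_negf)
  finally show ?thesis by simp
qed

text \<open>Adding or removing \<open>i\<close> is a sign-reversing involution.\<close>

lemma alternating_sum_eq_0:
  fixes f :: "'b set \<Rightarrow> 'c::comm_ring_1"
  assumes "finite I" "i \<in> I" and toggle: "\<And>S. S \<subseteq> I \<Longrightarrow> f (insert i S) = f S"
  shows "(\<Sum>S\<in>Pow I. (-1) ^ card S * f S) = 0"
proof -
  have "(\<Sum>S\<in>Pow (I - {i}). (-1) ^ card S * f (insert i S)) =
      (\<Sum>S\<in>Pow (I - {i}). (-1) ^ card S * f S)"
    by (intro sum.cong refl) (subst toggle, auto)
  then show ?thesis
    using alternating_sum_Pow_insert[of "I - {i}" i f] assms by (simp add: insert_absorb)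
qed

text \<open>The fibres of \<open>q\<close> contribute independent factors \<open>t - 1\<close>: the empty subset of a fibre gives
  \<open>t\<close>, and its nonempty subsets have signed count \<open>-1\<close>.  Inserting the elements one at a time, only
  the first element of each fibre changes the sum, because a further element of the same fibre can
  be cancelled against the earlier one.\<close>

lemma alternating_sum_missed_classes:
  fixes t :: "'c::comm_ring_1"
  assumes "finite I"
  shows "(\<Sum>S\<in>Pow I. (-1) ^ card S * t ^ card (q ` I - q ` S)) = (t - 1) ^ card (q ` I)"
  using assms
proof (induction I rule: finite_induct)
  case empty
  then show ?case by simp
next
  case (insert i J)
  note split = alternating_sum_Pow_insert[OF insert.hyps,
    of "\<lambda>S. t ^ card (q ` insert i J - q ` S)"]
  show ?case
  proof (cases "q i \<in> q ` J")
    case True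
    then obtain j where j: "j \<in> J" "q j = q i" by auto
    have "(\<Sum>S\<in>Pow J. (-1) ^ card S * t ^ card (q ` insert i J - q ` insert i S)) = 0"
      using j by (intro alternating_sum_eq_0[OF insert.hyps(1) j(1)]) simp
    moreover have "q ` insert i J = q ` J"
      using True by auto
    ultimately show ?thesis
      using split insert.IH by simp
  next
    case False
    have "card (q ` insert i J - q ` S) = Suc (card (q ` J - q ` S))" if "S \<in> Pow J" for S
    proof -
      have "q ` insert i J - q ` S = insert (q i) (q ` J - q ` S)"
        using that False by auto
      then show ?thesis
        using that False insert.hyps(1) by (simp add: card_insert_disjoint)
    qed
    then have "(\<Sum>S\<in>Pow J. (-1) ^ card S * t ^ card (q ` insert i J - q ` S)) =
        t * (t - 1) ^ card (q ` J)"
      by (simp add: insert.IH[symmetric] sum_distrib_left mult_ac)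
    moreover have "q ` insert i J - q ` insert i S = q ` J - q ` S" for S
      using False by auto
    moreover have "card (q ` insert i J) = Suc (card (q ` J))"
      using False insert.hyps(1) by simp
    ultimately show ?thesis
      using split insert.IH by (simp add: algebra_simps)
  qed
qed

section \<open>Whitney's theorem\<close>

lemma flats_image:
  "flats (H ` I) = {\<Inter>(H ` B) | B. B \<subseteq> I \<and> \<Inter>(H ` B) \<noteq> {}}"
  unfolding flats_def by (auto simp: subset_image_iff)

text \<open>The right-hand side satisfies the recursion that defines the Moebius function.  Summed over all
  flats containing \<open>X\<close>, it becomes the alternating sum over all sets of hyperplanes that contain
  \<open>X\<close>, which vanishes unless there is no such hyperplane, that is, unless \<open>X\<close> is the whole space.
  The family \<open>H\<close> may repeat a hyperplane, so an arrangement can be indexed by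
  its equations.\<close>

lemma moebius_intersection_poset_eq_alternating_sum:
  fixes H :: "'b \<Rightarrow> 'a::euclidean_space set"
  assumes fin: "finite I" and proper: "\<And>i. i \<in> I \<Longrightarrow> H i \<noteq> UNIV"
    and X: "X \<in> flats (H ` I)"
  shows "moebius (intersection_poset (H ` I)) UNIV X =
    (\<Sum>B | B \<subseteq> I \<and> \<Inter>(H ` B) = X. (-1) ^ card B)"
  using X
proof (induction X rule: measure_induct_rule[where f = "\<lambda>X. card {Y \<in> flats (H ` I). X \<subset> Y}"])
  case (less X)
  let ?F = "flats (H ` I)" and ?r = "intersection_poset (H ` I)"
  let ?g = "\<lambda>X. \<Sum>B | B \<subseteq> I \<and> \<Inter>(H ` B) = X. (-1) ^ card B :: int"
  have finF: "finite ?F"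
    unfolding flats_image
    by (rule finite_subset[of _ "(\<lambda>B. \<Inter>(H ` B)) ` Pow I"]) (use fin in auto)
  have UF: "UNIV \<in> ?F"
    unfolding flats_image by (rule CollectI, rule exI[of _ "{}"]) auto
  have po: "Partial_order ?r"
    unfolding partial_order_on_def preorder_on_def refl_on_def trans_on_def antisym_on_def
      intersection_poset_def Field_def
    by auto
  have ne: "X \<noteq> {}"
    using less.prems unfolding flats_image by auto
  show ?case
  proof (cases "X = UNIV")
    case True
    have "{B. B \<subseteq> I \<and> \<Inter>(H ` B) = UNIV} = {{}}"
      using proper by blast
    then show ?thesis
      using True po UF finF
      by (subst moebius.simps) (auto simp: intersection_poset_def elim: finite_subset[rotated])
  next
    case False
    let ?J = "{i \<in> I. X \<subseteq> H i}"
    have above: "{Z. (UNIV, Z) \<in> ?r \<and> (Z, X) \<in> ?r \<and> Z \<noteq> X} = {Z \<in> ?F. X \<subset> Z}"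
      using UF less.prems by (auto simp: intersection_poset_def)
    have "moebius ?r UNIV X = - (\<Sum>Z \<in> {Z \<in> ?F. X \<subset> Z}. moebius ?r UNIV Z)"
      using False po UF finF less.prems unfolding above[symmetric]
      by (subst moebius.simps) (auto simp: intersection_poset_def)
    also have "(\<Sum>Z \<in> {Z \<in> ?F. X \<subset> Z}. moebius ?r UNIV Z) = (\<Sum>Z \<in> {Z \<in> ?F. X \<subset> Z}. ?g Z)"
    proof (intro sum.cong refl less.IH)
      fix Z assume Z: "Z \<in> {Z \<in> ?F. X \<subset> Z}"
      then have "{Y \<in> ?F. Z \<subset> Y} \<subset> {Y \<in> ?F. X \<subset> Y}" by auto
      then show "card {Y \<in> ?F. Z \<subset> Y} < card {Y \<in> ?F. X \<subset> Y}"
        using finF by (intro psubset_card_mono) auto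
    qed auto
    finally have moeb: "moebius ?r UNIV X = - (\<Sum>Z \<in> {Z \<in> ?F. X \<subset> Z}. ?g Z)" .
    have "(\<Sum>Z \<in> {Z \<in> ?F. X \<subseteq> Z}. ?g Z) =
        (\<Sum>Z \<in> {Z \<in> ?F. X \<subseteq> Z}. \<Sum>B | B \<in> Pow ?J \<and> \<Inter>(H ` B) = Z. (-1) ^ card B)"
      by (intro sum.cong refl) auto
    also have "\<dots> = (\<Sum>B \<in> Pow ?J. (-1) ^ card B)"
      using fin finF ne by (intro sum.group) (auto simp: flats_image)
    also have "\<dots> = 0"
    proof -
      obtain B where "B \<subseteq> I" "\<Inter>(H ` B) = X"
        using less.prems unfolding flats_image by auto
      then obtain i where "i \<in> ?J"
        using False by blast
      then show ?thesis
        using alternating_sum_eq_0[of ?J i "\<lambda>_. 1 :: int"] fin by simp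
    qed
    finally have "(\<Sum>Z \<in> {Z \<in> ?F. X \<subseteq> Z}. ?g Z) = 0" .
    moreover have "{Z \<in> ?F. X \<subseteq> Z} = insert X {Z \<in> ?F. X \<subset> Z}"
      using less.prems by auto
    ultimately show ?thesis
      using moeb finF by simp
  qed
qed

text \<open>Group the subfamilies by the flat in which they intersect.\<close>

theorem whitney_characteristic_poly:
  fixes H :: "'b \<Rightarrow> 'a::euclidean_space set"
  assumes fin: "finite I" and proper: "\<And>i. i \<in> I \<Longrightarrow> H i \<noteq> UNIV"
  shows "characteristic_poly (H ` I) =
    (\<Sum>B | B \<subseteq> I \<and> \<Inter>(H ` B) \<noteq> {}. (-1) ^ card B * monom 1 (nat (aff_dim (\<Inter>(H ` B)))))"
proof -
  let ?F = "flats (H ` I)"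
  let ?C = "{B. B \<subseteq> I \<and> \<Inter>(H ` B) \<noteq> {}}"
  have F: "?F = (\<lambda>B. \<Inter>(H ` B)) ` ?C"
    unfolding flats_image by auto
  have finC: "finite ?C"
    by (rule finite_subset[of _ "Pow I"]) (use fin in auto)
  have sgn: "monom ((-1) ^ k :: int) d = (-1) ^ k * monom 1 d" for k d
    by (cases "even k") (simp_all add: minus_monom)
  have "characteristic_poly (H ` I) =
      (\<Sum>X\<in>?F. \<Sum>B | B \<in> ?C \<and> \<Inter>(H ` B) = X. (-1) ^ card B * monom 1 (nat (aff_dim (\<Inter>(H ` B)))))"
    unfolding characteristic_poly_def
  proof (intro sum.cong refl)
    fix X assume X: "X \<in> ?F"
    then have "X \<noteq> {}" unfolding flats_image by auto
    then have *: "{B. B \<subseteq> I \<and> \<Inter>(H ` B) = X} = {B. B \<in> ?C \<and> \<Inter>(H ` B) = X}"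
      by auto
    have "moebius (intersection_poset (H ` I)) UNIV X =
        (\<Sum>B | B \<in> ?C \<and> \<Inter>(H ` B) = X. (-1) ^ card B)"
      using moebius_intersection_poset_eq_alternating_sum[OF fin proper X] unfolding * by simp
    then show "monom (moebius (intersection_poset (H ` I)) UNIV X) (nat (aff_dim X)) =
        (\<Sum>B | B \<in> ?C \<and> \<Inter>(H ` B) = X. (-1) ^ card B * monom 1 (nat (aff_dim (\<Inter>(H ` B)))))"
      by (auto simp: monom_sum sgn intro!: sum.cong)
  qed
  also have "\<dots> = (\<Sum>B\<in>?C. (-1) ^ card B * monom 1 (nat (aff_dim (\<Inter>(H ` B)))))"
    using finC by (intro sum.group) (auto simp: F)
  finally show ?thesis .
qed

section \<open>Dimensions of solution spaces\<close>

text \<open>A system of equations between coordinates is solved by choosing a representative \<open>q i\<close> in the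
  class of each index \<open>i\<close>.  The proof takes \<open>i\<close> and \<open>j\<close> to be equivalent if the system forces
  \<open>z i = z j\<close>; this gives the equivalence closure of \<open>R\<close> without any reasoning about paths.\<close>

lemma equations_via_representatives:
  fixes R :: "('n \<times> 'n) set"
  obtains q where "\<And>i. q (q i) = q i"
    "\<And>z :: 'n \<Rightarrow> real. (\<forall>(i, j)\<in>R. z i = z j) \<longleftrightarrow> (\<forall>i. z i = z (q i))"
proof -
  define E where "E i j \<longleftrightarrow> (\<forall>z :: 'n \<Rightarrow> real. (\<forall>(i, j)\<in>R. z i = z j) \<longrightarrow> z i = z j)" for i j
  define q where "q i = (SOME j. E i j)" for i
  have "E i i" for i
    by (simp add: E_def)
  then have q: "E i (q i)" for i
    unfolding q_def by (rule someI)
  have q_eq: "q i = q j" if "E i j" for i j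
  proof -
    have "E i = E j"
      using that unfolding E_def by (intro ext iff_allI imp_cong refl) auto
    then show ?thesis by (simp add: q_def)
  qed
  show ?thesis
  proof
    show "q (q i) = q i" for i
      using q_eq[OF q] by simp
    show "(\<forall>(i, j)\<in>R. z i = z j) \<longleftrightarrow> (\<forall>i. z i = z (q i))" for z :: "'n \<Rightarrow> real"
    proof
      assume "\<forall>(i, j)\<in>R. z i = z j"
      then show "\<forall>i. z i = z (q i)"
        using q unfolding E_def by blast
    next
      assume z: "\<forall>i. z i = z (q i)"
      have "q i = q j" if "(i, j) \<in> R" for i j
        using that by (intro q_eq) (auto simp: E_def)
      then show "\<forall>(i, j)\<in>R. z i = z j"
        using z by (auto; metis)
    qed
  qed
qed

text \<open>The free parameters are the values at the representatives of the classes without an element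
  of \<open>S\<close>; on any other class \<open>x\<close> vanishes, since the factors \<open>c i\<close> are nonzero.\<close>

lemma aff_dim_proportional_classes:
  fixes c :: "'n::finite \<Rightarrow> real"
  assumes idem: "\<And>i. q (q i) = q i" and c: "\<And>i. c i \<noteq> 0" and c1: "\<And>i. c (q i) = 1"
  shows "aff_dim {x :: real ^ 'n. (\<forall>i. x $ i = c i * x $ q i) \<and> (\<forall>i\<in>S. x $ i = 0)} =
    int (card (range q - q ` S))"
proof -
  let ?V = "{x :: real ^ 'n. (\<forall>i. x $ i = c i * x $ q i) \<and> (\<forall>i\<in>S. x $ i = 0)}"
  let ?D = "range q - q ` S"
  let ?W = "{w :: real ^ 'n. \<forall>i. i \<notin> ?D \<longrightarrow> w $ i = 0}"
  define f :: "real ^ 'n \<Rightarrow> real ^ 'n" where "f w = (\<chi> i. c i * w $ q i)" for w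
  have lin: "linear f"
    by (rule linearI) (auto simp: f_def vec_eq_iff algebra_simps)
  have subW: "subspace ?W"
    by (auto simp: subspace_def)
  have inj: "inj_on f ?W"
  proof (rule inj_onI)
    fix v w assume v: "v \<in> ?W" and w: "w \<in> ?W" and eq: "f v = f w"
    have "v $ q i = w $ q i" for i
      using arg_cong[OF eq, of "\<lambda>x. x $ i"] c[of i] by (simp add: f_def)
    moreover have "v $ i = 0 \<and> w $ i = 0" if "i \<notin> range q" for i
      using that v w by auto
    ultimately show "v = w"
      unfolding vec_eq_iff by (metis rangeE)
  qed
  have "f ` ?W = ?V"
  proof
    show "f ` ?W \<subseteq> ?V"
      by (auto simp: f_def idem c1)
    show "?V \<subseteq> f ` ?W"
    proof
      fix x assume x: "x \<in> ?V"
      let ?w = "(\<chi> i. if i \<in> ?D then x $ i else 0) :: real ^ 'n"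
      have zero: "x $ i = 0" if qi: "q i \<in> q ` S" for i
      proof -
        obtain j where j: "j \<in> S" "q i = q j" using qi by blast
        have "x $ j = c j * x $ q j" "x $ i = c i * x $ q i" "x $ j = 0"
          using x j by blast+
        then show ?thesis using c[of j] j by simp
      qed
      have "x $ i = c i * ?w $ q i" for i
      proof (cases "q i \<in> q ` S")
        case True
        then show ?thesis by (simp add: zero)
      next
        case False
        have "x $ i = c i * x $ q i" using x by blast
        then show ?thesis using False by simp
      qed
      then have "x = f ?w"
        by (simp add: f_def vec_eq_iff)
      moreover have "?w \<in> ?W" by simp
      ultimately show "x \<in> f ` ?W" by blast
    qed
  qed
  moreover have "dim (f ` ?W) = dim ?W"
    using inj subW by (intro dim_image_eq[OF lin]) (simp add: span_eq_iff[THEN iffD2])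
  moreover have "dim ?W = card ?D"
    using dim_substandard_cart[of ?D, where 'a = real] by (simp add: dim_vec_eq)
  moreover have "subspace ?V"
    using linear_subspace_image[OF lin subW] \<open>f ` ?W = ?V\<close> by simp
  ultimately show ?thesis
    by (simp add: aff_dim_subspace)
qed

text \<open>A real vector space is not a finite union of proper subspaces.  Here the witness is built one
  coordinate at a time, as \<open>y + c x\<close> for a scalar \<open>c\<close> that avoids the finitely many values at which
  one of the coordinates cancels.\<close>

lemma subspace_generic_vector:
  fixes V :: "(real ^ 'n::finite) set"
  assumes V: "subspace V" and nz: "\<And>i. \<exists>x\<in>V. x $ i \<noteq> 0"
  obtains x where "x \<in> V" "\<And>i. x $ i \<noteq> 0"
proof -
  have "\<exists>x\<in>V. \<forall>i\<in>F. x $ i \<noteq> 0" if "finite F" for F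
    using that
  proof (induction F rule: finite_induct)
    case empty
    then show ?case using subspace_0[OF V] by auto
  next
    case (insert j F)
    then obtain x where x: "x \<in> V" "\<forall>i\<in>F. x $ i \<noteq> 0" by blast
    obtain y where y: "y \<in> V" "y $ j \<noteq> 0" using nz by blast
    have "finite ((\<lambda>i. - y $ i / x $ i) ` insert j F)"
      using insert.hyps by simp
    then obtain c where c: "c \<notin> (\<lambda>i. - y $ i / x $ i) ` insert j F"
      using ex_new_if_finite[OF infinite_UNIV_char_0] by blast
    have "y $ i + c * x $ i \<noteq> 0" if "i \<in> insert j F" for i
    proof (cases "x $ i = 0")
      case True
      then show ?thesis using that x y by auto
    next
      case False
      have "c \<noteq> - y $ i / x $ i" using c that by blast
      then show ?thesis using False by (auto simp: field_simps add_eq_0_iff)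
    qed
    moreover have "y + c *\<^sub>R x \<in> V"
      using V x y by (simp add: subspace_add subspace_scale)
    ultimately show ?case
      by (intro bexI[of _ "y + c *\<^sub>R x"]) auto
  qed
  from this[of UNIV] show thesis using that by auto
qed

section \<open>The multiplicative and the additive system\<close>

definition exp_solutions :: "real \<Rightarrow> ('n \<times> 'n \<times> int) set \<Rightarrow> (real ^ 'n::finite) set" where
  "exp_solutions a T = {x. \<forall>(i, j, k)\<in>T. x $ i = a powi k * x $ j}"

definition affine_solutions :: "('n \<times> 'n \<times> int) set \<Rightarrow> (real ^ 'n::finite) set" where
  "affine_solutions T = {x. \<forall>(i, j, k)\<in>T. x $ i - x $ j = of_int k}"

lemma subspace_exp_solutions: "subspace (exp_solutions a T)"
  by (auto simp: exp_solutions_def subspace_def algebra_simps; fastforce)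

text \<open>Logarithms of absolute values map a solution of the multiplicative system without zero
  coordinates to a solution of the additive system.  If the latter has none, no generic vector of
  the multiplicative solution space can have all its coordinates nonzero.\<close>

lemma exp_solutions_vanishing_coordinate:
  assumes a: "a > 1" and empty: "affine_solutions T = {}"
  obtains i where "\<And>x. x \<in> exp_solutions a T \<Longrightarrow> x $ i = 0"
proof (rule ccontr)
  assume "\<not> thesis"
  then have "\<exists>x\<in>exp_solutions a T. x $ i \<noteq> 0" for i
    using that by blast
  then obtain x where x: "x \<in> exp_solutions a T" "\<And>i. x $ i \<noteq> 0"
    using subspace_generic_vector[OF subspace_exp_solutions] by metis
  have "(\<chi> i. log a \<bar>x $ i\<bar>) \<in> affine_solutions T"
    unfolding affine_solutions_def
  proof (clarsimp)
    fix i j k assume "(i, j, k) \<in> T"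
    then have "x $ i = a powi k * x $ j"
      using x by (auto simp: exp_solutions_def)
    then have "\<bar>x $ i\<bar> = a powr of_int k * \<bar>x $ j\<bar>"
      using a by (simp add: abs_mult powr_real_of_int')
    then show "log a (\<bar>x $ i\<bar>) - log a (\<bar>x $ j\<bar>) = of_int k"
      using a x(2)[of j] by (simp add: log_mult)
  qed
  then show False using empty by simp
qed

text \<open>A solution \<open>y\<close> of the additive system trivialises both systems.  Every \<open>k\<close> becomes
  \<open>y $ i - y $ j\<close>, so the additive equations say that \<open>x - y\<close> is constant on classes, and
  the multiplicative ones that \<open>a powr - (y $ i) * x $ i\<close> is.  Both dimensions
  are therefore read off from the same map \<open>q\<close> to representatives.\<close>

lemma aff_dim_solutions:
  fixes T :: "('n::finite \<times> 'n \<times> int) set"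
  assumes a: "a > 1" and y: "y \<in> affine_solutions T"
  obtains q :: "'n \<Rightarrow> 'n" where "aff_dim (affine_solutions T) = int (card (range q))"
    "\<And>S. aff_dim {x \<in> exp_solutions a T. \<forall>i\<in>S. x $ i = 0} = int (card (range q - q ` S))"
proof -
  let ?R = "(\<lambda>(i, j, k). (i, j)) ` T"
  obtain q where idem: "\<And>i. q (q i) = q i" and
    q: "\<And>z :: 'n \<Rightarrow> real. (\<forall>(i, j)\<in>?R. z i = z j) \<longleftrightarrow> (\<forall>i. z i = z (q i))"
    using equations_via_representatives[of ?R] by blast
  have qT: "(\<forall>(i, j, k)\<in>T. z i = z j) \<longleftrightarrow> (\<forall>i. z i = z (q i))" for z :: "'n \<Rightarrow> real"
    using q[of z] by (simp add: case_prod_unfold)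
  have yT: "of_int k = y $ i - y $ j" if "(i, j, k) \<in> T" for i j k
    using y that by (auto simp: affine_solutions_def)
  let ?U = "{z :: real ^ 'n. (\<forall>i. z $ i = 1 * z $ q i) \<and> (\<forall>i\<in>{}. z $ i = 0)}"
  have "affine_solutions T = (+) y ` ?U"
  proof -
    have "x \<in> affine_solutions T \<longleftrightarrow> x - y \<in> ?U" for x
    proof -
      have "x \<in> affine_solutions T \<longleftrightarrow> (\<forall>(i, j, k)\<in>T. x $ i - y $ i = x $ j - y $ j)"
        unfolding affine_solutions_def mem_Collect_eq
        by (intro ball_cong refl) (auto dest!: yT simp: algebra_simps)
      also have "\<dots> \<longleftrightarrow> x - y \<in> ?U"
        using qT[of "\<lambda>i. x $ i - y $ i"] by simp
      finally show ?thesis .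
    qed
    moreover have "x \<in> (+) y ` ?U \<longleftrightarrow> x - y \<in> ?U" for x
      by (auto simp: image_iff intro!: exI[of _ "x - y"])
    ultimately show ?thesis by blast
  qed
  then have 1: "aff_dim (affine_solutions T) = int (card (range q))"
    using aff_dim_proportional_classes[OF idem, of "\<lambda>_. 1" "{}"]
    by (simp add: aff_dim_translation_eq)
  have "x \<in> exp_solutions a T \<longleftrightarrow> (\<forall>i. x $ i = a powr (y $ i - y $ q i) * x $ q i)" for x
  proof -
    have scale: "u = a powr (y $ i - y $ j) * v \<longleftrightarrow> a powr - (y $ i) * u = a powr - (y $ j) * v"
      for u v i j
      using a by (auto simp: powr_diff powr_minus field_simps)
    have "x \<in> exp_solutions a T \<longleftrightarrow> (\<forall>(i, j, k)\<in>T. x $ i = a powr (y $ i - y $ j) * x $ j)"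
      unfolding exp_solutions_def mem_Collect_eq
      by (intro ball_cong refl) (use yT a in \<open>auto simp: powr_real_of_int'[symmetric]\<close>)
    also have "\<dots> \<longleftrightarrow> (\<forall>i. x $ i = a powr (y $ i - y $ q i) * x $ q i)"
      unfolding scale by (rule qT[of "\<lambda>i. a powr - (y $ i) * x $ i"])
    finally show ?thesis .
  qed
  then have 2: "aff_dim {x \<in> exp_solutions a T. \<forall>i\<in>S. x $ i = 0} = int (card (range q - q ` S))" for S
    using aff_dim_proportional_classes[OF idem, of "\<lambda>i. a powr (y $ i - y $ q i)" S] a
    by (simp add: idem)
  show thesis by (rule that[OF 1 2])
qed

text \<open>This is where \<open>t\<close> becomes \<open>t - 1\<close> and where the families without a common point in the additive
  arrangement drop out.\<close>

lemma sum_over_coordinate_subsets: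
  fixes T :: "('n::finite \<times> 'n \<times> int) set"
  assumes a: "a > 1"
  shows "(\<Sum>S\<in>Pow UNIV. (-1) ^ card S *
      monom 1 (nat (aff_dim {x \<in> exp_solutions a T. \<forall>i\<in>S. x $ i = 0}))) =
    (if affine_solutions T = {} then 0
     else [:-1, 1:] ^ nat (aff_dim (affine_solutions T)) :: int poly)"
proof (cases "affine_solutions T = {}")
  case True
  obtain i where i: "\<And>x. x \<in> exp_solutions a T \<Longrightarrow> x $ i = 0"
    using exp_solutions_vanishing_coordinate[OF a True] by blast
  have "{x \<in> exp_solutions a T. \<forall>j\<in>insert i S. x $ j = 0} =
      {x \<in> exp_solutions a T. \<forall>j\<in>S. x $ j = 0}" for S
    using i by auto
  then show ?thesis
    using True alternating_sum_eq_0[of UNIV i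
        "\<lambda>S. monom (1 :: int) (nat (aff_dim {x \<in> exp_solutions a T. \<forall>i\<in>S. x $ i = 0}))"]
    by simp
next
  case False
  then obtain y where y: "y \<in> affine_solutions T" by blast
  obtain q :: "'n \<Rightarrow> 'n" where q: "aff_dim (affine_solutions T) = int (card (range q))"
    "\<And>S. aff_dim {x \<in> exp_solutions a T. \<forall>i\<in>S. x $ i = 0} = int (card (range q - q ` S))"
    by (rule aff_dim_solutions[OF a y]) (rule that; blast)
  have "[:-1, 1:] = monom 1 1 - (1 :: int poly)"
    by (simp add: monom_altdef one_pCons)
  then show ?thesis
    using False alternating_sum_missed_classes[of "UNIV :: 'n set" "monom 1 1 :: int poly" q]
    by (simp add: q monom_power)
qed

section \<open>Comparison of the two arrangements\<close>

theorem corollary2p13: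
  fixes m :: nat and a :: real
  assumes "m \<ge> 1" and "a > 1"
  shows "characteristic_poly (exp_catalan_arrangement m a :: (real ^ 'n::{finite,linorder}) set set) =
    pcompose (characteristic_poly (catalan_arrangement m :: (real ^ 'n::{finite,linorder}) set set)) [:-1, 1:]"
proof -
  note a = \<open>a > 1\<close>
  define E :: "('n \<times> 'n \<times> int) set" where "E = {(i, j, k). i < j \<and> k \<in> {- int m..int m}}"
  define C :: "'n \<times> 'n \<times> int \<Rightarrow> (real, 'n) vec set" where
    "C = (\<lambda>(i, j, k). {x. x $ i - x $ j = of_int k})"
  define H :: "'n + 'n \<times> 'n \<times> int \<Rightarrow> (real, 'n) vec set" where
    "H = case_sum (\<lambda>i. {x. x $ i = 0}) (\<lambda>(i, j, k). {x. x $ i = a powi k * x $ j})"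
  let ?V = "\<lambda>S T. {x \<in> exp_solutions a T. \<forall>i\<in>S. x $ i = 0}"
  have finE: "finite E"
    by (rule finite_subset[of _ "UNIV \<times> UNIV \<times> {- int m..int m}"]) (auto simp: E_def)
  have C_arr: "catalan_arrangement m = C ` E"
    unfolding catalan_arrangement_def C_def E_def by (auto simp: image_iff; blast)
  have H_arr: "exp_catalan_arrangement m a = H ` (UNIV <+> E)"
    unfolding exp_catalan_arrangement_def H_def E_def Plus_def image_Un image_image
    by (auto simp: image_iff; blast)
  have C_proper: "C e \<noteq> UNIV" if eE: "e \<in> E" for e
  proof -
    obtain i j k where e: "e = (i, j, k)" "i \<noteq> j" using eE by (auto simp: E_def)
    then have "axis i (of_int k + 1) \<notin> C e" by (simp add: C_def axis_def)
    then show ?thesis by blast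
  qed
  have H_proper: "H h \<noteq> UNIV" if hI: "h \<in> UNIV <+> E" for h
  proof (cases h)
    case (Inl i)
    then have "axis i 1 \<notin> H h" by (simp add: H_def axis_def)
    then show ?thesis by blast
  next
    case (Inr e)
    then obtain i j k where e: "h = Inr (i, j, k)" "i \<noteq> j" using hI by (auto simp: E_def)
    then have "axis i 1 \<notin> H h" by (simp add: H_def axis_def)
    then show ?thesis by blast
  qed
  have C_Inter: "\<Inter>(C ` T) = affine_solutions T" for T
    by (auto simp: C_def affine_solutions_def)
  have H_Inter: "\<Inter>(H ` (S <+> T)) = ?V S T" for S T
    by (auto simp: H_def exp_solutions_def Plus_def ball_Un)
  \<comment> \<open>No subfamily of the exponential arrangement is excluded from Whitney's sum, since all of its
    hyperplanes pass through the origin.\<close>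
  have subsets: "bij_betw (\<lambda>(T, S). S <+> T) (Pow E \<times> Pow UNIV)
      {B. B \<subseteq> UNIV <+> E \<and> \<Inter>(H ` B) \<noteq> {}}"
  proof (rule bij_betwI[where g = "\<lambda>B. (Inr -` B, Inl -` B)"])
    have split: "Inl -` B <+> Inr -` B = B" for B :: "('n + 'n \<times> 'n \<times> int) set"
    proof (rule set_eqI)
      show "x \<in> Inl -` B <+> Inr -` B \<longleftrightarrow> x \<in> B" for x
        by (cases x) auto
    qed
    have "0 \<in> ?V S T" for S and T :: "('n \<times> 'n \<times> int) set"
      using subspace_0[OF subspace_exp_solutions] by auto
    then have "\<Inter>(H ` (S <+> T)) \<noteq> {}" for S T
      unfolding H_Inter by blast
    then show "(\<lambda>(T, S). S <+> T) \<in> Pow E \<times> Pow UNIV \<rightarrow>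
        {B. B \<subseteq> UNIV <+> E \<and> \<Inter>(H ` B) \<noteq> {}}"
      by auto
    show "(case (Inr -` B, Inl -` B) of (T, S) \<Rightarrow> S <+> T) = B"
      for B :: "('n + 'n \<times> 'n \<times> int) set"
      using split by simp
  qed auto
  have "characteristic_poly (exp_catalan_arrangement m a :: (real, 'n) vec set set) =
      (\<Sum>B | B \<subseteq> UNIV <+> E \<and> \<Inter>(H ` B) \<noteq> {}.
        (-1) ^ card B * monom 1 (nat (aff_dim (\<Inter>(H ` B)))))"
    unfolding H_arr by (rule whitney_characteristic_poly) (use finE H_proper in auto)
  also have "\<dots> =
      (\<Sum>(T, S)\<in>Pow E \<times> Pow UNIV. (-1) ^ card (S <+> T) * monom 1 (nat (aff_dim (?V S T))))"
    unfolding sum.reindex_bij_betw[OF subsets, symmetric] by (simp add: case_prod_unfold H_Inter)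
  also have "\<dots> = (\<Sum>T\<in>Pow E. (-1) ^ card T *
      (\<Sum>S\<in>Pow UNIV. (-1) ^ card S * monom 1 (nat (aff_dim (?V S T)))))"
    unfolding sum.cartesian_product[symmetric] sum_distrib_left
  proof (intro sum.cong refl)
    fix T S assume "T \<in> Pow E" "S \<in> Pow (UNIV :: 'n set)"
    then have "card (S <+> T) = card S + card T"
      using finE by (intro card_Plus) (auto intro: finite_subset)
    then show "(-1) ^ card (S <+> T) * monom 1 (nat (aff_dim (?V S T))) =
        (-1) ^ card T * ((-1) ^ card S * monom (1 :: int) (nat (aff_dim (?V S T))))"
      by (simp add: power_add mult_ac)
  qed
  also have "\<dots> = (\<Sum>T\<in>Pow E. if affine_solutions T = {} then 0
      else (-1) ^ card T * [:-1, 1:] ^ nat (aff_dim (affine_solutions T)))"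
    unfolding sum_over_coordinate_subsets[OF a] by (intro sum.cong) auto
  also have "\<dots> = (\<Sum>T | T \<subseteq> E \<and> affine_solutions T \<noteq> {}.
      (-1) ^ card T * [:-1, 1:] ^ nat (aff_dim (affine_solutions T)))"
    using finE by (intro sum.mono_neutral_cong_right) auto
  also have "\<dots> = pcompose (characteristic_poly (C ` E)) [:-1, 1:]"
  proof -
    have mon: "pcompose (monom 1 d) p = p ^ d" for d and p :: "int poly"
      by (induction d) (simp_all add: monom_Suc pcompose_pCons pcompose_1 monom_0 flip: one_pCons)
    have pc: "pcompose ((-1) ^ k * monom 1 d) p = (-1) ^ k * p ^ d" for k d and p :: "int poly"
      by (cases "even k") (simp_all add: mon pcompose_uminus)
    show ?thesis
      by (subst whitney_characteristic_poly[OF finE C_proper])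
        (simp_all add: C_Inter pcompose_sum pc)
  qed
  finally show ?thesis
    unfolding C_arr .
qed

end
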